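(* Let $k$ be a positive integer, let $\{A_i\}_{i=1}^k$ be nonempty closed subsets of a $0$-complete partial metric space $(X,p)$, and suppose that $T:\bigcup_{i=1}^k A_i\to\bigcup_{i=1}^k A_i$ satisfies the following conditions, where $A_{k+1}=A_1$: (1) $T(A_i)\subseteq A_{i+1}$ for $1\le i\le k$; (2) there exists $\alpha\in(0,1)$ such that $p(T(x),T(y))\le\alpha\, p(x,y)$ for all $x\in A_i$, $y\in A_{i+1}$ and $1\le i\le k$. Then $T$ has a unique fixed point.
   Context: A partial metric space is a pair $(X,p)$ with $p:X\times X\to[0,\infty)$ such that for all $x,y,z\in X$: (P1) $p(x,y)=p(y,x)$; (P2) if $p(x,x)=p(x,y)=p(y,y)$ then $x=y$; (P3) $p(x,x)\le p(x,y)$; (P4) $p(x,z)+p(y,y)\le p(x,y)+p(y,z)$. The topology $\tau_p$ on $X$ has as base the open $p$-balls $B_p(x,\varepsilon)=\{y\in X: p(x,y)<p(x,x)+\varepsilon\}$, $x\in X$, $\varepsilon>0$; "closed" means closed with respect to $\tau_p$. A sequence $\{x_n\}$ converges to $x\in X$ (with respect to $\tau_p$) if and only if $\lim_{n\to\infty}p(x,x_n)=p(x,x)$. A sequence $\{x_n\}$ is $0$-Cauchy if $\lim_{m,n\to\infty}p(x_n,x_m)=0$. The space $(X,p)$ is $0$-complete if every $0$-Cauchy sequence in $X$ converges with respect to $\tau_p$ to a point $x\in X$ with $p(x,x)=0$. *)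

theory Defs
  imports "HOL-Analysis.Analysis"
begin

locale Partial_Metric_space =
  fixes X :: "'a set" and p :: "'a \<Rightarrow> 'a \<Rightarrow> real"
  assumes nonneg: "\<lbrakk>x \<in> X; y \<in> X\<rbrakk> \<Longrightarrow> 0 \<le> p x y"
    and commute: "\<lbrakk>x \<in> X; y \<in> X\<rbrakk> \<Longrightarrow> p x y = p y x"
    and separation: "\<lbrakk>x \<in> X; y \<in> X; p x x = p x y; p x y = p y y\<rbrakk> \<Longrightarrow> x = y"
    and self_le: "\<lbrakk>x \<in> X; y \<in> X\<rbrakk> \<Longrightarrow> p x x \<le> p x y"
    and triangle: "\<lbrakk>x \<in> X; y \<in> X; z \<in> X\<rbrakk> \<Longrightarrow> p x z + p y y \<le> p x y + p y z"
begin

definition pmball :: "'a \<Rightarrow> real \<Rightarrow> 'a set" where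
  "pmball x \<epsilon> = {y \<in> X. p x y < p x x + \<epsilon>}"

definition pmballs :: "'a set set" where
  "pmballs = {pmball x \<epsilon> | x \<epsilon>. x \<in> X \<and> \<epsilon> > 0}"

definition pmtopology :: "'a topology" where
  "pmtopology = topology (arbitrary union_of (\<lambda>U. U \<in> pmballs))"

definition zero_Cauchy :: "(nat \<Rightarrow> 'a) \<Rightarrow> bool" where
  "zero_Cauchy \<sigma> \<longleftrightarrow>
     range \<sigma> \<subseteq> X \<and> ((\<lambda>(m, n). p (\<sigma> n) (\<sigma> m)) \<longlongrightarrow> 0) (sequentially \<times>\<^sub>F sequentially)"

definition zero_complete :: bool where
  "zero_complete \<longleftrightarrow>
     (\<forall>\<sigma>. zero_Cauchy \<sigma> \<longrightarrow> (\<exists>x\<in>X. limitin pmtopology \<sigma> x sequentially \<and> p x x = 0))"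

lemma centre_in_pmball: "\<lbrakk>x \<in> X; \<epsilon> > 0\<rbrakk> \<Longrightarrow> x \<in> pmball x \<epsilon>"
  by (simp add: pmball_def)

lemma pmball_shrink:
  assumes "x \<in> X" "y \<in> pmball x \<epsilon>"
  obtains \<delta> where "\<delta> > 0" "pmball y \<delta> \<subseteq> pmball x \<epsilon>"
proof
  have y: "y \<in> X" "p x y < p x x + \<epsilon>"
    using assms by (auto simp: pmball_def)
  show "p x x + \<epsilon> - p x y > 0"
    using y by simp
  show "pmball y (p x x + \<epsilon> - p x y) \<subseteq> pmball x \<epsilon>"
  proof
    fix z assume z: "z \<in> pmball y (p x x + \<epsilon> - p x y)"
    then have "p x z + p y y \<le> p x y + p y z"
      using assms(1) y by (intro triangle) (auto simp: pmball_def)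
    with z show "z \<in> pmball x \<epsilon>"
      by (auto simp: pmball_def)
  qed
qed

text \<open>The \<^const>\<open>topology\<close> constructor is meaningful only for genuine topologies, so
  the balls must be shown to form a base.\<close>

lemma openin_pmtopology: "openin pmtopology = arbitrary union_of (\<lambda>U. U \<in> pmballs)"
proof -
  have "(arbitrary union_of (\<lambda>U. U \<in> pmballs)) (U \<inter> V)"
    if "U \<in> pmballs" "V \<in> pmballs" for U V
  proof -
    obtain x \<epsilon> y \<delta> where UV: "U = pmball x \<epsilon>" "V = pmball y \<delta>" "x \<in> X" "y \<in> X"
      using \<open>U \<in> pmballs\<close> \<open>V \<in> pmballs\<close> by (auto simp: pmballs_def)
    have "\<exists>W. W \<in> pmballs \<and> z \<in> W \<and> W \<subseteq> U \<inter> V" if z: "z \<in> U \<inter> V" for z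
    proof -
      obtain a where a: "a > 0" "pmball z a \<subseteq> U"
        using z UV by (auto elim: pmball_shrink[of x z \<epsilon>])
      obtain b where b: "b > 0" "pmball z b \<subseteq> V"
        using z UV by (auto elim: pmball_shrink[of y z \<delta>])
      note ab = a b
      have zX: "z \<in> X"
        using z UV by (auto simp: pmball_def)
      have "pmball z (min a b) \<subseteq> U \<inter> V"
        using ab by (auto simp: pmball_def)
      moreover have "pmball z (min a b) \<in> pmballs"
        unfolding pmballs_def using zX ab by (intro CollectI exI[of _ z] exI[of _ "min a b"]) auto
      moreover have "z \<in> pmball z (min a b)"
        using zX ab by (intro centre_in_pmball) auto
      ultimately show ?thesis by blast
    qed
    then show ?thesis
      unfolding arbitrary_union_of_alt by blast
  qed
  then have "istopology (arbitrary union_of (\<lambda>U. U \<in> pmballs))"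
    by (simp add: istopology_base_eq)
  then show ?thesis
    by (simp add: pmtopology_def)
qed

lemma openin_pmtopology_alt:
  "openin pmtopology U \<longleftrightarrow> U \<subseteq> X \<and> (\<forall>x\<in>U. \<exists>\<epsilon>>0. pmball x \<epsilon> \<subseteq> U)"
proof
  assume "openin pmtopology U"
  then have *: "\<exists>W. W \<in> pmballs \<and> x \<in> W \<and> W \<subseteq> U" if "x \<in> U" for x
    using that by (auto simp: openin_pmtopology arbitrary_union_of_alt)
  show "U \<subseteq> X \<and> (\<forall>x\<in>U. \<exists>\<epsilon>>0. pmball x \<epsilon> \<subseteq> U)"
  proof (intro conjI ballI subsetI)
    fix x assume "x \<in> U"
    then obtain y \<epsilon> where y: "y \<in> X" "x \<in> pmball y \<epsilon>" "pmball y \<epsilon> \<subseteq> U"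
      using * by (fastforce simp: pmballs_def)
    then show "x \<in> X" by (auto simp: pmball_def)
    obtain \<delta> where "\<delta> > 0" "pmball x \<delta> \<subseteq> pmball y \<epsilon>"
      using y(1,2) by (rule pmball_shrink)
    with y show "\<exists>\<epsilon>>0. pmball x \<epsilon> \<subseteq> U" by blast
  qed
next
  assume R: "U \<subseteq> X \<and> (\<forall>x\<in>U. \<exists>\<epsilon>>0. pmball x \<epsilon> \<subseteq> U)"
  have "\<exists>W. W \<in> pmballs \<and> x \<in> W \<and> W \<subseteq> U" if "x \<in> U" for x
  proof -
    obtain \<epsilon> where "\<epsilon> > 0" "pmball x \<epsilon> \<subseteq> U" "x \<in> X"
      using R \<open>x \<in> U\<close> by blast
    then show ?thesis
      using centre_in_pmball unfolding pmballs_def by blast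
  qed
  then show "openin pmtopology U"
    by (auto simp: openin_pmtopology arbitrary_union_of_alt)
qed

lemma openin_pmball:
  assumes "x \<in> X"
  shows "openin pmtopology (pmball x \<epsilon>)"
  unfolding openin_pmtopology_alt
proof (intro conjI ballI)
  show "pmball x \<epsilon> \<subseteq> X"
    by (auto simp: pmball_def)
  fix y assume "y \<in> pmball x \<epsilon>"
  with assms obtain \<delta> where "\<delta> > 0" "pmball y \<delta> \<subseteq> pmball x \<epsilon>"
    by (rule pmball_shrink)
  then show "\<exists>\<delta>>0. pmball y \<delta> \<subseteq> pmball x \<epsilon>"
    by blast
qed

lemma topspace_pmtopology: "topspace pmtopology = X"
proof
  show "topspace pmtopology \<subseteq> X"
    using openin_pmtopology_alt[of "topspace pmtopology"] by simp
  have "openin pmtopology X"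
    unfolding openin_pmtopology_alt pmball_def by (auto intro: exI[of _ 1])
  then show "X \<subseteq> topspace pmtopology"
    by (rule openin_subset)
qed

lemma limitin_pmtopology:
  assumes "range \<sigma> \<subseteq> X"
  shows "limitin pmtopology \<sigma> x sequentially \<longleftrightarrow> x \<in> X \<and> (\<lambda>n. p x (\<sigma> n)) \<longlonglongrightarrow> p x x"
proof -
  have X: "\<sigma> n \<in> X" for n
    using assms by auto
  have "limitin pmtopology \<sigma> x sequentially \<longleftrightarrow>
      x \<in> X \<and> (\<forall>\<epsilon>>0. \<forall>\<^sub>F n in sequentially. \<sigma> n \<in> pmball x \<epsilon>)" (is "_ \<longleftrightarrow> ?R")
  proof
    assume "limitin pmtopology \<sigma> x sequentially"
    then show ?R
      using openin_pmball centre_in_pmball by (auto simp: limitin_def topspace_pmtopology)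
  next
    assume R: ?R
    show "limitin pmtopology \<sigma> x sequentially"
      unfolding limitin_def topspace_pmtopology
    proof (intro conjI allI impI)
      show "x \<in> X" using R by blast
      fix U assume "openin pmtopology U \<and> x \<in> U"
      then obtain \<epsilon> where "\<epsilon> > 0" and U: "pmball x \<epsilon> \<subseteq> U"
        unfolding openin_pmtopology_alt by blast
      then have "\<forall>\<^sub>F n in sequentially. \<sigma> n \<in> pmball x \<epsilon>"
        using R by blast
      then show "\<forall>\<^sub>F n in sequentially. \<sigma> n \<in> U"
        by (rule eventually_mono) (use U in blast)
    qed
  qed
  also have "\<dots> \<longleftrightarrow> x \<in> X \<and> (\<lambda>n. p x (\<sigma> n)) \<longlonglongrightarrow> p x x"
  proof (rule conj_cong[OF refl])
    assume x: "x \<in> X"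
    have "\<sigma> n \<in> pmball x \<epsilon> \<longleftrightarrow> dist (p x (\<sigma> n)) (p x x) < \<epsilon>" for n \<epsilon>
      using self_le[OF x X[of n]] X[of n] by (auto simp: pmball_def dist_real_def)
    then show "(\<forall>\<epsilon>>0. \<forall>\<^sub>F n in sequentially. \<sigma> n \<in> pmball x \<epsilon>) \<longleftrightarrow> (\<lambda>n. p x (\<sigma> n)) \<longlonglongrightarrow> p x x"
      by (simp add: tendsto_iff)
  qed
  finally show ?thesis .
qed

end

end

theory Submission imports Defs begin

text \<open>The Picard iterates \<open>T\<^sup>n a\<close> satisfy
  \<open>p (T\<^sup>n a) (T (T\<^sup>n a)) \<le> \<alpha>\<^sup>n p a (T a)\<close>, so they form a 0-Cauchy sequence and converge to
  some \<open>x\<close> with \<open>p x x = 0\<close>. They visit every \<open>A i\<close> infinitely often, so by closedness \<open>x\<close>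
  lies in all the \<open>A i\<close>. Hence the contraction inequality is available between \<open>x\<close> and any
  point of the union: applied to the iterates it gives \<open>T x = x\<close>, and applied to another fixed
  point it gives uniqueness.\<close>

context Partial_Metric_space
begin

text \<open>By \<open>self_le\<close> both self-distances lie between 0 and \<open>p x y\<close>, so
  all three values vanish and \<open>separation\<close> applies.\<close>

lemma eq_if_zero:
  assumes "x \<in> X" "y \<in> X" "p x y = 0"
  shows "x = y"
  using assms self_le[of x y] self_le[of y x] nonneg[of x x] nonneg[of y y] commute[of x y]
  by (intro separation) auto

lemma geometric_tail:
  assumes X: "range \<sigma> \<subseteq> X" and \<alpha>: "0 < \<alpha>" "\<alpha> < 1"
    and step: "\<And>n. p (\<sigma> n) (\<sigma> (Suc n)) \<le> c * \<alpha> ^ n"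
  shows "p (\<sigma> m) (\<sigma> (m + j)) \<le> c / (1 - \<alpha>) * \<alpha> ^ m"
proof (induction j arbitrary: m)
  case 0
  have \<sigma>: "\<sigma> n \<in> X" for n
    using X by auto
  have "0 \<le> c"
    using nonneg[OF \<sigma>[of 0] \<sigma>[of 1]] step[of 0] by simp
  \<comment> \<open>The base case has content because a self-distance may be positive; it is bounded
    by the distance to the next term.\<close>
  then have "c * \<alpha> ^ m \<le> c / (1 - \<alpha>) * \<alpha> ^ m"
    using \<alpha> by (intro mult_right_mono) (auto simp: field_simps)
  then show ?case
    using self_le[OF \<sigma>[of m] \<sigma>[of "Suc m"]] step[of m] by simp
next
  case (Suc j)
  have \<sigma>: "\<sigma> n \<in> X" for n
    using X by auto
  have "p (\<sigma> m) (\<sigma> (m + Suc j)) \<le> p (\<sigma> m) (\<sigma> (Suc m)) + p (\<sigma> (Suc m)) (\<sigma> (Suc m + j))"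
    using triangle[OF \<sigma>[of m] \<sigma>[of "Suc m"] \<sigma>[of "Suc m + j"]] nonneg[OF \<sigma>[of "Suc m"] \<sigma>[of "Suc m"]]
    by simp
  also have "\<dots> \<le> c * \<alpha> ^ m + c / (1 - \<alpha>) * \<alpha> ^ Suc m"
    by (intro add_mono step Suc.IH)
  also have "\<dots> = c / (1 - \<alpha>) * \<alpha> ^ m"
    using \<alpha> by (simp add: field_simps)
  finally show ?case .
qed

lemma zero_Cauchy_geometric:
  assumes X: "range \<sigma> \<subseteq> X" and \<alpha>: "0 < \<alpha>" "\<alpha> < 1"
    and step: "\<And>n. p (\<sigma> n) (\<sigma> (Suc n)) \<le> c * \<alpha> ^ n"
  shows "zero_Cauchy \<sigma>"
proof -
  have \<sigma>: "\<sigma> n \<in> X" for n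
    using X by auto
  define C where "C = c / (1 - \<alpha>)"
  have tail: "p (\<sigma> m) (\<sigma> n) \<le> C * \<alpha> ^ m" if "m \<le> n" for m n
    using geometric_tail[OF X \<alpha> step, of m "n - m"] that by (simp add: C_def)
  have "0 \<le> C * \<alpha> ^ n" for n
    using tail[of n n] nonneg[OF \<sigma>[of n] \<sigma>[of n]] by simp
  \<comment> \<open>Adding both tails gives a bound that does not depend on which index is
    smaller.\<close>
  then have bound: "p (\<sigma> n) (\<sigma> m) \<le> C * \<alpha> ^ m + C * \<alpha> ^ n" for m n
    using tail[of m n] tail[of n m] commute[OF \<sigma>[of m] \<sigma>[of n]]
    by (cases "m \<le> n") (auto intro: add_increasing add_increasing2)
  have lim: "(\<lambda>n. C * \<alpha> ^ n) \<longlonglongrightarrow> 0"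
    using \<alpha> by (intro tendsto_mult_right_zero LIMSEQ_realpow_zero) auto
  have "((\<lambda>z. C * \<alpha> ^ fst z + C * \<alpha> ^ snd z) \<longlongrightarrow> 0) (sequentially \<times>\<^sub>F sequentially)"
    using tendsto_add[OF filterlim_compose[OF lim filterlim_fst]
        filterlim_compose[OF lim filterlim_snd]] by simp
  then have "((\<lambda>(m, n). p (\<sigma> n) (\<sigma> m)) \<longlongrightarrow> 0) (sequentially \<times>\<^sub>F sequentially)"
    by (rule tendsto_sandwich[OF _ _ tendsto_const, rotated 2])
      (auto intro!: always_eventually nonneg \<sigma> bound simp: split_beta)
  with X show ?thesis
    by (simp add: zero_Cauchy_def)
qed

end

text \<open>A limit outside \<open>S\<close> would have the open complement of \<open>S\<close> as a
  neighbourhood, keeping \<open>f\<close> out of \<open>S\<close> eventually. Frequent visits are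
  the right notion here, since the orbit is only guaranteed to meet a given \<open>A i\<close> once
  in \<open>k\<close> steps.\<close>

lemma limitin_closedin_frequently:
  assumes "limitin U f l F" "closedin U S" "frequently (\<lambda>x. f x \<in> S) F"
  shows "l \<in> S"
proof (rule ccontr)
  assume "l \<notin> S"
  then have "\<forall>\<^sub>F x in F. f x \<in> topspace U - S"
    using assms(1,2) openin_diff[OF openin_topspace assms(2)] unfolding limitin_def by blast
  then have "\<forall>\<^sub>F x in F. f x \<notin> S"
    by (rule eventually_mono) auto
  with assms(3) show False
    by (simp add: frequently_def)
qed

theorem theorem5:
  fixes X :: "'a set" and p :: "'a \<Rightarrow> 'a \<Rightarrow> real"
    and k :: nat and A :: "nat \<Rightarrow> 'a set" and T :: "'a \<Rightarrow> 'a"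
  assumes "Partial_Metric_space X p"
    and "Partial_Metric_space.zero_complete X p"
    and "k \<ge> 1"
    and "\<And>i. i \<in> {1..k} \<Longrightarrow> A i \<noteq> {}"
    and "\<And>i. i \<in> {1..k} \<Longrightarrow> closedin (Partial_Metric_space.pmtopology X p) (A i)"
    and "A (k + 1) = A 1"
    and "T \<in> (\<Union>i\<in>{1..k}. A i) \<rightarrow> (\<Union>i\<in>{1..k}. A i)"
    and "\<And>i. i \<in> {1..k} \<Longrightarrow> T ` A i \<subseteq> A (i + 1)"
    and "\<exists>\<alpha>\<in>{0<..<1}. \<forall>i\<in>{1..k}. \<forall>x\<in>A i. \<forall>y\<in>A (i + 1). p (T x) (T y) \<le> \<alpha> * p x y"
  shows "\<exists>!x. x \<in> (\<Union>i\<in>{1..k}. A i) \<and> T x = x"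
proof -
  interpret Partial_Metric_space X p by fact
  obtain \<alpha> where \<alpha>: "0 < \<alpha>" "\<alpha> < 1"
    and contr: "\<And>i x y. \<lbrakk>i \<in> {1..k}; x \<in> A i; y \<in> A (i + 1)\<rbrakk> \<Longrightarrow> p (T x) (T y) \<le> \<alpha> * p x y"
    using assms(9) by auto
  have AX: "A i \<subseteq> X" if "i \<in> {1..k}" for i
    using closedin_subset[OF assms(5)[OF that]] by (simp add: topspace_pmtopology)
  have succ: "\<exists>j\<in>{1..k}. A (i + 1) = A j" if "i \<in> {1..k}" for i
    using that assms(3,6) by (cases "i = k") (auto intro: bexI[of _ 1] bexI[of _ "i + 1"])

  obtain a where a: "a \<in> A 1"
    using assms(3,4) by fastforce
  define \<sigma> where "\<sigma> n = (T ^^ n) a" for n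
  have \<sigma>_Suc: "\<sigma> (Suc n) = T (\<sigma> n)" for n
    by (simp add: \<sigma>_def)
  have idx: "n mod k + 1 \<in> {1..k}" for n
    using assms(3) by (auto simp: Suc_le_eq)
  \<comment> \<open>The residue wraps to 0 when \<open>Suc (n mod k) = k\<close>; there the claim is
    \<open>A 1 = A (k + 1)\<close>.\<close>
  have A_Suc: "A (Suc n mod k + 1) = A (n mod k + 1 + 1)" for n
    using assms(6) by (auto simp: mod_Suc)
  have \<sigma>A: "\<sigma> n \<in> A (n mod k + 1)" for n
  proof (induction n)
    case 0
    show ?case using a by (simp add: \<sigma>_def)
  next
    case (Suc n)
    then show ?case
      using assms(8)[OF idx[of n]] unfolding \<sigma>_Suc A_Suc by blast
  qed
  have \<sigma>: "\<sigma> n \<in> X" for n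
    using \<sigma>A[of n] AX[OF idx[of n]] by blast
  then have range: "range \<sigma> \<subseteq> X" by auto
  have step: "p (\<sigma> n) (\<sigma> (Suc n)) \<le> p (\<sigma> 0) (\<sigma> 1) * \<alpha> ^ n" for n
  proof (induction n)
    case (Suc n)
    have "p (\<sigma> (Suc n)) (\<sigma> (Suc (Suc n))) \<le> \<alpha> * p (\<sigma> n) (\<sigma> (Suc n))"
      using contr[OF idx \<sigma>A, of "\<sigma> (Suc n)" n] \<sigma>A[of "Suc n"]
      by (simp only: A_Suc \<sigma>_Suc)
    also have "\<dots> \<le> \<alpha> * (p (\<sigma> 0) (\<sigma> 1) * \<alpha> ^ n)"
      using \<alpha> Suc.IH by (intro mult_left_mono) auto
    finally show ?case by (simp add: mult_ac)
  qed simp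
  have "zero_Cauchy \<sigma>"
    using range \<alpha> step by (rule zero_Cauchy_geometric)
  then obtain x where x: "x \<in> X" "limitin pmtopology \<sigma> x sequentially" "p x x = 0"
    using assms(2) by (auto simp: zero_complete_def)
  then have lim: "(\<lambda>n. p x (\<sigma> n)) \<longlonglongrightarrow> 0"
    using limitin_pmtopology[OF range, of x] by simp

  have xA: "x \<in> A i" if i: "i \<in> {1..k}" for i
  proof (rule limitin_closedin_frequently[OF x(2) assms(5)[OF i]])
    show "\<exists>\<^sub>F n in sequentially. \<sigma> n \<in> A i"
      unfolding frequently_sequentially
    proof
      fix N
      have "i - 1 < k"
        using i by auto
      \<comment> \<open>The time \<open>i - 1 + N * k\<close> has the residue that belongs to
        \<open>A i\<close> and is at least \<open>N\<close>.\<close>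
      then have "(i - 1 + N * k) mod k + 1 = i"
        using i by (simp only: mod_mult_self1 mod_less) auto
      then have "\<sigma> (i - 1 + N * k) \<in> A i"
        using \<sigma>A[of "i - 1 + N * k"] by (simp only:)
      moreover have "N \<le> N * k"
        using assms(3) by (cases k) auto
      ultimately show "\<exists>n\<ge>N. \<sigma> n \<in> A i"
        using trans_le_add2 by blast
    qed
  qed
  \<comment> \<open>As \<open>x\<close> lies in every set of the cycle, it lies in the successor of
    whichever set contains \<open>y\<close>.\<close>
  have contr_x: "p (T y) (T x) \<le> \<alpha> * p y x" if "i \<in> {1..k}" "y \<in> A i" for i y
  proof -
    have "x \<in> A (i + 1)"
      using succ[OF that(1)] xA by auto
    with that show ?thesis
      by (rule contr)
  qed
  have one: "1 \<in> {1..k}"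
    using assms(3) by simp
  have TU: "T x \<in> (\<Union>i\<in>{1..k}. A i)"
    using assms(7) xA[OF one] one by blast
  then have TX: "T x \<in> X"
    using AX by blast

  \<comment> \<open>Pass through \<open>\<sigma> (Suc n) = T (\<sigma> n)\<close>; both terms tend
    to 0 because \<open>p x x = 0\<close>.\<close>
  have "p x (T x) \<le> p x (\<sigma> (Suc n)) + \<alpha> * p x (\<sigma> n)" for n
  proof -
    have "p x (T x) \<le> p x (\<sigma> (Suc n)) + p (\<sigma> (Suc n)) (T x)"
      using triangle[OF x(1) \<sigma>[of "Suc n"] TX] nonneg[OF \<sigma>[of "Suc n"] \<sigma>[of "Suc n"]] by simp
    moreover have "p (\<sigma> (Suc n)) (T x) \<le> \<alpha> * p (\<sigma> n) x"
      using contr_x[OF idx \<sigma>A] by (simp add: \<sigma>_Suc)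
    ultimately show ?thesis
      using commute[OF x(1) \<sigma>[of n]] by simp
  qed
  moreover have "(\<lambda>n. p x (\<sigma> (Suc n)) + \<alpha> * p x (\<sigma> n)) \<longlonglongrightarrow> 0"
    using tendsto_add[OF LIMSEQ_Suc[OF lim] tendsto_mult_right_zero[OF lim, of \<alpha>]] by simp
  ultimately have "p x (T x) \<le> 0"
    by (intro LIMSEQ_le_const) auto
  then have fix_x: "T x = x"
    using eq_if_zero[OF x(1) TX] nonneg[OF x(1) TX] by simp

  show ?thesis
  proof (rule ex1I[of _ x])
    show "x \<in> (\<Union>i\<in>{1..k}. A i) \<and> T x = x"
      using TU fix_x by simp
  next
    fix y assume y: "y \<in> (\<Union>i\<in>{1..k}. A i) \<and> T y = y"
    then obtain i where i: "i \<in> {1..k}" "y \<in> A i" by blast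
    then have yX: "y \<in> X" using AX by blast
    have "(1 - \<alpha>) * p y x \<le> 0"
      using contr_x[OF i] y fix_x by (simp add: algebra_simps)
    then have "p y x = 0"
      using \<alpha> nonneg[OF yX x(1)] by (simp add: mult_le_0_iff)
    then show "y = x"
      by (rule eq_if_zero[OF yX x(1)])
  qed
qed

end
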